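(* Let $n\ge 2$, $0<R_0<R_1<+\infty$, $\Omega=\{x\in\mathbb{R}^n: R_0<|x|<R_1\}$, and for $i=1,2$ let $f_i:[R_0,R_1]\times[0,+\infty)^4\to[0,+\infty)$ be continuous. Fix intervals $[a_1,b_1]\subset(0,1)$ and $[a_2,b_2]\subset(0,1]$ (with $a_i<b_i$) and let $c_1=\min\{a_1,1-b_1\}$, $c_2=a_2$. With the notation of the context, assume that one of the following two conditions holds: (i) for each $i=1,2$, $$f_i(r,w_1,w_2,z_1,z_2)<\frac{m_i}{\sup_{t\in[0,1]}p(t)}\,w_i$$ for all $r\in[R_0,R_1]$ and all $w_1,w_2,z_1,z_2\in[0,+\infty)$ with $w_i>0$; (ii) for each $i=1,2$, $$f_i(r,w_1,w_2,z_1,z_2)>\frac{M_i}{\inf_{t\in[a_i,b_i]}p(t)}\,w_i$$ for all $r\in[R_0,R_1]$ and all $w_1,w_2,z_1,z_2\in[0,+\infty)$ with $w_i>0$. Then the system $$\begin{cases}-\Delta u=f_1(|x|,u,v,|\nabla u|,|\nabla v|)\ \text{ in }\Omega,\\ -\Delta v=f_2(|x|,u,v,|\nabla u|,|\nabla v|)\ \text{ in }\Omega,\\ u=0\ \text{ on }\partial\Omega,\\ v=0\ \text{ on }|x|=R_0\ \text{ and }\ \dfrac{\partial v}{\partial r}=0\ \text{ on }|x|=R_1\end{cases}$$ has no positive radial solution (in the sense defined in the context); that is, the only possible radial solution $(u,v)\in K$ is the zero one.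
   Context: Here $\partial/\partial r$ is differentiation in the radial direction $r=|x|$. Change of variable. For $t\in[0,1]$ set $r(t)=R_1^{1-t}R_0^{t}$ if $n=2$, and $r(t)=\left(\frac{A}{B-t}\right)^{1/(n-2)}$ if $n\ge3$, where $A=\frac{(R_0R_1)^{n-2}}{R_1^{n-2}-R_0^{n-2}}$ and $B=\frac{R_1^{n-2}}{R_1^{n-2}-R_0^{n-2}}$. Set $p(t)=r^2(t)\log^2(R_1/R_0)$ if $n=2$, and $$p(t)=\left(\frac{R_0R_1(R_1^{n-2}-R_0^{n-2})}{n-2}\right)^2\frac{1}{\left(R_1^{n-2}-(R_1^{n-2}-R_0^{n-2})t\right)^{2(n-1)/(n-2)}}\quad\text{if } n\ge3.$$ Radial solutions. Put $g_i(t,w_1,w_2,y_1,y_2)=p(t)\,f_i\!\left(r(t),w_1,w_2,\frac{y_1}{|r'(t)|},\frac{y_2}{|r'(t)|}\right)$ for $i=1,2$. By definition, a radial solution of the elliptic system means a solution $(u,v)$ of the system of ODEs $$-u''(t)=g_1(t,u(t),v(t),|u'(t)|,|v'(t)|),\quad -v''(t)=g_2(t,u(t),v(t),|u'(t)|,|v'(t)|)\ \text{ in }[0,1],$$ $$u(0)=u(1)=v(0)=v'(1)=0.$$ Cone and positivity. Let $\omega_1(t)=t(1-t)$, $\omega_2(t)=t$. For $i=1,2$ let $C^1_{\omega_i}[0,1]$ be the space of $w\in C[0,1]$ that are continuously differentiable on $(0,1)$ with $\|w'\|_{\omega_i}:=\sup_{t\in(0,1)}\omega_i(t)|w'(t)|<+\infty$,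 with norm $\|w\|=\max\{\|w\|_\infty,\|w'\|_{\omega_i}\}$, where $\|w\|_\infty=\max_{[0,1]}|w|$. On $C^1_{\omega_1}[0,1]\times C^1_{\omega_2}[0,1]$ use $\|(u,v)\|=\max\{\|u\|,\|v\|\}$. Let $$K_i=\left\{w\in C^1_{\omega_i}[0,1]: w\ge0,\ \min_{t\in[a_i,b_i]}w(t)\ge c_i\|w\|_\infty,\ \|w\|_\infty\ge\|w'\|_{\omega_i}\right\},\qquad K=K_1\times K_2.$$ A positive (radial) solution is a solution $(u,v)\in K$ of the ODE system $-u''(t)=g_1(t,u(t),v(t),|u'(t)|,|v'(t)|)$, $-v''(t)=g_2(t,u(t),v(t),|u'(t)|,|v'(t)|)$ in $[0,1]$, $u(0)=u(1)=v(0)=v'(1)=0$, with $\|(u,v)\|>0$. Constants. Let $k_1(t,s)=s(1-t)$ for $0\le s\le t\le1$ and $k_1(t,s)=t(1-s)$ for $0\le t\le s\le1$; let $k_2(t,s)=s$ for $0\le s\le t\le 1$ and $k_2(t,s)=t$ for $0\le t\le s\le1$. For $i=1,2$, $$m_i=\left(\sup_{t\in[0,1]}\int_0^1k_i(t,s)\,ds\right)^{-1}\ (\text{so } m_1=8,\ m_2=2),\qquad M_i=\left(\inf_{t\in[a_i,b_i]}\int_{a_i}^{b_i}k_i(t,s)\,ds\right)^{-1}.$$ *)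

theory Defs
  imports "HOL-Analysis.Analysis"
begin

text \<open>The change of variable. For \<open>n = 2\<close> it reverses the orientation
  (\<open>r 0 = R1\<close>, \<open>r 1 = R0\<close>); for \<open>n \<ge> 3\<close> it preserves it (\<open>r 0 = R0\<close>, \<open>r 1 = R1\<close>).\<close>

definition coef_A :: "nat \<Rightarrow> real \<Rightarrow> real \<Rightarrow> real" where
  "coef_A n R0 R1 = (R0 * R1) ^ (n - 2) / (R1 ^ (n - 2) - R0 ^ (n - 2))"

definition coef_B :: "nat \<Rightarrow> real \<Rightarrow> real \<Rightarrow> real" where
  "coef_B n R0 R1 = R1 ^ (n - 2) / (R1 ^ (n - 2) - R0 ^ (n - 2))"

definition r_of :: "nat \<Rightarrow> real \<Rightarrow> real \<Rightarrow> real \<Rightarrow> real" where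
  "r_of n R0 R1 t =
    (if n = 2 then R1 powr (1 - t) * R0 powr t
     else (coef_A n R0 R1 / (coef_B n R0 R1 - t)) powr (1 / (real n - 2)))"

definition p_of :: "nat \<Rightarrow> real \<Rightarrow> real \<Rightarrow> real \<Rightarrow> real" where
  "p_of n R0 R1 t =
    (if n = 2 then (r_of n R0 R1 t)\<^sup>2 * (ln (R1 / R0))\<^sup>2
     else (R0 * R1 * (R1 ^ (n - 2) - R0 ^ (n - 2)) / (real n - 2))\<^sup>2
       * (1 / (R1 ^ (n - 2) - (R1 ^ (n - 2) - R0 ^ (n - 2)) * t)
                powr (2 * (real n - 1) / (real n - 2))))"

text \<open>Functions of \<open>(r, w1, w2, z1, z2)\<close>. They are total in HOL; only their values on
  \<open>[R0, R1] \<times> [0, \<infinity>)\<^sup>4\<close> are ever constrained or used.\<close>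

type_synonym nonlin = "real \<Rightarrow> real \<Rightarrow> real \<Rightarrow> real \<Rightarrow> real \<Rightarrow> real"

definition admissible_nonlin :: "real \<Rightarrow> real \<Rightarrow> nonlin \<Rightarrow> bool" where
  "admissible_nonlin R0 R1 f \<longleftrightarrow>
    continuous_on ({R0..R1} \<times> {0..} \<times> {0..} \<times> {0..} \<times> {0..})
      (\<lambda>(r, w1, w2, z1, z2). f r w1 w2 z1 z2) \<and>
    (\<forall>r\<in>{R0..R1}. \<forall>w1\<ge>0. \<forall>w2\<ge>0. \<forall>z1\<ge>0. \<forall>z2\<ge>0. f r w1 w2 z1 z2 \<ge> 0)"

definition g_of :: "nat \<Rightarrow> real \<Rightarrow> real \<Rightarrow> nonlin \<Rightarrow> nonlin" where
  "g_of n R0 R1 f t w1 w2 y1 y2 =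
    p_of n R0 R1 t *
    f (r_of n R0 R1 t) w1 w2
      (y1 / \<bar>deriv (r_of n R0 R1) t\<bar>) (y2 / \<bar>deriv (r_of n R0 R1) t\<bar>)"

text \<open>Elements of the cone are differentiable on the open interval only, so the differential
  equations are required at the points of \<open>(0, 1)\<close>, where derivatives are two-sided.
  The condition \<open>v'(1) = 0\<close> is a one-sided derivative. Every solution that is twice
  differentiable up to the end points and satisfies the equations on all of \<open>[0, 1]\<close>
  is a solution in this sense; see \<open>radial_solution_if_classical\<close>.\<close>

definition radial_solution ::
  "nat \<Rightarrow> real \<Rightarrow> real \<Rightarrow> nonlin \<Rightarrow> nonlin \<Rightarrow> (real \<Rightarrow> real) \<Rightarrow> (real \<Rightarrow> real) \<Rightarrow> bool" where
  "radial_solution n R0 R1 f1 f2 u v \<longleftrightarrow>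
    continuous_on {0..1} u \<and> continuous_on {0..1} v \<and>
    (\<forall>t\<in>{0<..<1}.
      u differentiable at t \<and> v differentiable at t \<and>
      deriv u differentiable at t \<and> deriv v differentiable at t \<and>
      - deriv (deriv u) t = g_of n R0 R1 f1 t (u t) (v t) \<bar>deriv u t\<bar> \<bar>deriv v t\<bar> \<and>
      - deriv (deriv v) t = g_of n R0 R1 f2 t (u t) (v t) \<bar>deriv u t\<bar> \<bar>deriv v t\<bar>) \<and>
    u 0 = 0 \<and> u 1 = 0 \<and> v 0 = 0 \<and> (v has_real_derivative 0) (at 1 within {0..1})"

lemma deriv_of_within_01:
  fixes w w' w'' :: "real \<Rightarrow> real"
  assumes 1: "\<And>t. t \<in> {0..1} \<Longrightarrow> (w has_real_derivative w' t) (at t within {0..1})"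
    and 2: "\<And>t. t \<in> {0..1} \<Longrightarrow> (w' has_real_derivative w'' t) (at t within {0..1})"
    and t: "t \<in> {0<..<1}"
  shows "w differentiable at t \<and> deriv w t = w' t \<and>
    deriv w differentiable at t \<and> deriv (deriv w) t = w'' t"
proof -
  have at_eq: "at s within {0..1} = at s" if "s \<in> {0<..<1}" for s :: real
    using that by (intro at_within_interior) auto
  have d1: "(w has_real_derivative w' s) (at s)" if "s \<in> {0<..<1}" for s
    using 1[of s] at_eq[OF that] that by auto
  have "(w' has_real_derivative w'' t) (at t)"
    using 2[of t] at_eq[OF t] t by auto
  then have "(deriv w has_real_derivative w'' t) (at t)"
    by (rule has_field_derivative_transform_within_open[where S = "{0<..<1}"])
      (use t d1 DERIV_imp_deriv[symmetric] in auto)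
  with d1[OF t] show ?thesis
    by (auto simp: DERIV_imp_deriv real_differentiable_def)
qed

lemma radial_solution_if_classical:
  assumes u: "\<And>t. t \<in> {0..1} \<Longrightarrow> (u has_real_derivative u' t) (at t within {0..1})"
    and v: "\<And>t. t \<in> {0..1} \<Longrightarrow> (v has_real_derivative v' t) (at t within {0..1})"
    and u': "\<And>t. t \<in> {0..1} \<Longrightarrow> (u' has_real_derivative u'' t) (at t within {0..1})"
    and v': "\<And>t. t \<in> {0..1} \<Longrightarrow> (v' has_real_derivative v'' t) (at t within {0..1})"
    and eq1: "\<And>t. t \<in> {0..1} \<Longrightarrow> - u'' t = g_of n R0 R1 f1 t (u t) (v t) \<bar>u' t\<bar> \<bar>v' t\<bar>"
    and eq2: "\<And>t. t \<in> {0..1} \<Longrightarrow> - v'' t = g_of n R0 R1 f2 t (u t) (v t) \<bar>u' t\<bar> \<bar>v' t\<bar>"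
    and bc: "u 0 = 0" "u 1 = 0" "v 0 = 0" "v' 1 = 0"
  shows "radial_solution n R0 R1 f1 f2 u v"
  unfolding radial_solution_def
proof (intro conjI ballI)
  show "continuous_on {0..1} u" "continuous_on {0..1} v"
    using u v by (blast intro: DERIV_continuous_on)+
  show "(v has_real_derivative 0) (at 1 within {0..1})"
    using v[of 1] bc by simp
qed (use bc deriv_of_within_01[OF u u'] deriv_of_within_01[OF v v'] eq1 eq2 in simp_all)

text \<open>Functions on \<open>[0, 1]\<close> are represented by total functions; everything below depends only
  on their values on \<open>[0, 1]\<close>.\<close>

definition omega1 :: "real \<Rightarrow> real" where "omega1 t = t * (1 - t)"

definition omega2 :: "real \<Rightarrow> real" where "omega2 t = t"

definition sup_norm :: "(real \<Rightarrow> real) \<Rightarrow> real" where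
  "sup_norm w = (SUP t\<in>{0..1}. \<bar>w t\<bar>)"

definition deriv_norm :: "(real \<Rightarrow> real) \<Rightarrow> (real \<Rightarrow> real) \<Rightarrow> real" where
  "deriv_norm \<omega> w = (SUP t\<in>{0<..<1}. \<omega> t * \<bar>deriv w t\<bar>)"

definition weighted_C1 :: "(real \<Rightarrow> real) \<Rightarrow> (real \<Rightarrow> real) set" where
  "weighted_C1 \<omega> = {w. continuous_on {0..1} w \<and> w C1_differentiable_on {0<..<1} \<and>
    bdd_above ((\<lambda>t. \<omega> t * \<bar>deriv w t\<bar>) ` {0<..<1})}"

definition weighted_norm :: "(real \<Rightarrow> real) \<Rightarrow> (real \<Rightarrow> real) \<Rightarrow> real" where
  "weighted_norm \<omega> w = max (sup_norm w) (deriv_norm \<omega> w)"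

definition pair_norm :: "(real \<Rightarrow> real) \<times> (real \<Rightarrow> real) \<Rightarrow> real" where
  "pair_norm = (\<lambda>(u, v). max (weighted_norm omega1 u) (weighted_norm omega2 v))"

definition cone :: "(real \<Rightarrow> real) \<Rightarrow> real \<Rightarrow> real \<Rightarrow> real \<Rightarrow> (real \<Rightarrow> real) set" where
  "cone \<omega> a b c = {w \<in> weighted_C1 \<omega>. (\<forall>t\<in>{0..1}. w t \<ge> 0) \<and>
    (INF t\<in>{a..b}. w t) \<ge> c * sup_norm w \<and> sup_norm w \<ge> deriv_norm \<omega> w}"

definition cone_K ::
  "real \<Rightarrow> real \<Rightarrow> real \<Rightarrow> real \<Rightarrow> ((real \<Rightarrow> real) \<times> (real \<Rightarrow> real)) set" where
  "cone_K a1 b1 a2 b2 =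
    cone omega1 a1 b1 (min a1 (1 - b1)) \<times> cone omega2 a2 b2 a2"

definition positive_radial_solution ::
  "nat \<Rightarrow> real \<Rightarrow> real \<Rightarrow> nonlin \<Rightarrow> nonlin \<Rightarrow> real \<Rightarrow> real \<Rightarrow> real \<Rightarrow> real \<Rightarrow>
    (real \<Rightarrow> real) \<Rightarrow> (real \<Rightarrow> real) \<Rightarrow> bool" where
  "positive_radial_solution n R0 R1 f1 f2 a1 b1 a2 b2 u v \<longleftrightarrow>
    (u, v) \<in> cone_K a1 b1 a2 b2 \<and> radial_solution n R0 R1 f1 f2 u v \<and> pair_norm (u, v) > 0"

definition k1 :: "real \<Rightarrow> real \<Rightarrow> real" where
  "k1 t s = (if s \<le> t then s * (1 - t) else t * (1 - s))"

definition k2 :: "real \<Rightarrow> real \<Rightarrow> real" where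
  "k2 t s = (if s \<le> t then s else t)"

definition m_const :: "(real \<Rightarrow> real \<Rightarrow> real) \<Rightarrow> real" where
  "m_const k = inverse (SUP t\<in>{0..1}. integral {0..1} (k t))"

definition M_const :: "(real \<Rightarrow> real \<Rightarrow> real) \<Rightarrow> real \<Rightarrow> real \<Rightarrow> real" where
  "M_const k a b = inverse (INF t\<in>{a..b}. integral {a..b} (k t))"

end

theory Submission
  imports Defs
begin

text \<open>
  No Green's function representation of solutions is needed: \<open>\<kappa> \<integral>\<^sub>a\<^sup>b k t s ds\<close> satisfies the boundary
  conditions, has second derivative \<open>- \<kappa>\<close> on \<open>(a, b)\<close> and \<open>0\<close> outside, and is an explicit quadratic
  polynomial on \<open>[a, b]\<close>, so solutions can be compared with it using only monotonicity of first
  derivatives. Under (i) a nonzero component with maximum \<open>N\<close> lies strictly below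
  \<open>m N \<integral>\<^sub>0\<^sup>1 k t s ds \<le> N\<close> where the maximum is attained, and under (ii) a nonzero component with
  minimum \<open>\<mu>\<close> on \<open>[a, b]\<close> lies strictly above \<open>M \<mu> \<integral>\<^sub>a\<^sup>b k t s ds \<ge> \<mu>\<close> where the minimum is attained.
\<close>

section \<open>Comparison for scalar boundary value problems\<close>

text \<open>The derivative is a named function \<open>f'\<close>, so that the mean values obtained
  on different intervals can be compared through the monotonicity of \<open>f'\<close>.\<close>

lemma mean_value:
  fixes f f' :: "real \<Rightarrow> real"
  assumes "c < d" "continuous_on {c..d} f"
    and "\<And>s. s \<in> {c<..<d} \<Longrightarrow> (f has_real_derivative f' s) (at s)"
  obtains z where "z \<in> {c<..<d}" "f d - f c = (d - c) * f' z"
proof -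
  obtain l z where z: "c < z" "z < d" "DERIV f z :> l" "f d - f c = (d - c) * l"
    using MVT[of c d f] assms by (meson greaterThanLessThan_iff real_differentiable_def)
  moreover have "l = f' z" using z assms(3) by (intro DERIV_unique[OF z(3)]) auto
  ultimately show ?thesis using that by auto
qed

lemma strict_decr_if_deriv_neg:
  fixes f f' :: "real \<Rightarrow> real"
  assumes "\<And>s. s \<in> {x..y} \<Longrightarrow> (f has_real_derivative f' s) (at s)"
    and "\<And>s. s \<in> {x..y} \<Longrightarrow> f' s < 0" and "x < y"
  shows "f y < f x"
  using DERIV_neg_imp_decreasing[of x y f] assms by (metis atLeastAtMost_iff)

lemma decr_if_deriv_nonpos:
  fixes f f' :: "real \<Rightarrow> real"
  assumes "\<And>s. s \<in> {x..y} \<Longrightarrow> (f has_real_derivative f' s) (at s)"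
    and "\<And>s. s \<in> {x..y} \<Longrightarrow> f' s \<le> 0" and "x \<le> y"
  shows "f y \<le> f x"
  using DERIV_nonpos_imp_nonincreasing[of x y f] assms by (metis atLeastAtMost_iff)

text \<open>The Neumann condition is a limit of difference quotients at 1. By the mean value theorem
  each quotient is a value of \<open>w'\<close> to the right of \<open>t\<close>, hence at most
  \<open>w' t\<close>; in the limit \<open>0 \<le> w' t\<close>. Nothing is assumed about
  \<open>w'\<close> at 1 itself.\<close>

lemma deriv_nonneg_if_neumann:
  fixes w w' :: "real \<Rightarrow> real"
  assumes cont: "continuous_on {0..1} w"
    and w: "\<And>s. s \<in> {0<..<1} \<Longrightarrow> (w has_real_derivative w' s) (at s)"
    and decr: "\<And>x y. 0 < x \<Longrightarrow> x \<le> y \<Longrightarrow> y < 1 \<Longrightarrow> w' y \<le> w' x"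
    and end1: "(w has_real_derivative 0) (at 1 within {0..1})"
    and t: "t \<in> {0<..<1}"
  shows "0 \<le> w' t"
proof -
  have t1: "t < 1" using t by simp
  have "((\<lambda>x. (w x - w 1) / (x - 1)) \<longlongrightarrow> 0) (at 1 within {0..1})"
    using end1 by (simp add: has_field_derivative_iff)
  moreover have "at 1 within {0..1} = at_left (1::real)"
    by (rule at_within_Icc_at_left) simp
  ultimately have lim: "((\<lambda>x. (w x - w 1) / (x - 1)) \<longlongrightarrow> 0) (at_left 1)" by simp
  have "\<forall>\<^sub>F x in at_left 1. (w x - w 1) / (x - 1) \<le> w' t"
    using eventually_at_left_real[OF t1]
  proof eventually_elim
    case (elim x)
    obtain z where z: "z \<in> {x<..<1}" "w 1 - w x = (1 - x) * w' z"
    proof (rule mean_value[of x 1 w w'])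
      show "continuous_on {x..1} w" using elim t by (intro continuous_on_subset[OF cont]) auto
      show "(w has_real_derivative w' s) (at s)" if "s \<in> {x<..<1}" for s
        using that elim t by (intro w) auto
    qed (use elim in auto)
    have "(w x - w 1) / (x - 1) = w' z"
      using z elim by (simp add: field_simps)
    also have "\<dots> \<le> w' t" using z elim t by (intro decr) auto
    finally show ?case .
  qed
  from tendsto_upperbound[OF lim this] show ?thesis by simp
qed

text \<open>If \<open>w t \<le> 0\<close>, the mean slope is nonpositive on \<open>[0, t]\<close>
  and nonnegative on \<open>[t, 1]\<close>, which contradicts the strict decrease of
  \<open>w'\<close>.\<close>

lemma dirichlet_concave_pos:
  fixes w w' w'' :: "real \<Rightarrow> real"
  assumes cont: "continuous_on {0..1} w"
    and w: "\<And>s. s \<in> {0<..<1} \<Longrightarrow> (w has_real_derivative w' s) (at s)"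
    and w': "\<And>s. s \<in> {0<..<1} \<Longrightarrow> (w' has_real_derivative w'' s) (at s)"
    and neg: "\<And>s. s \<in> {0<..<1} \<Longrightarrow> w'' s < 0"
    and ends: "0 \<le> w 0" "0 \<le> w 1" and t: "t \<in> {0<..<1}"
  shows "0 < w t"
proof (rule ccontr)
  assume n: "\<not> 0 < w t"
  obtain x where x: "x \<in> {0<..<t}" "w t - w 0 = (t - 0) * w' x"
    using t by (elim mean_value[of 0 t w w', rotated 3])
      (auto intro!: w continuous_on_subset[OF cont])
  obtain y where y: "y \<in> {t<..<1}" "w 1 - w t = (1 - t) * w' y"
    using t by (elim mean_value[of t 1 w w', rotated 3])
      (auto intro!: w continuous_on_subset[OF cont])
  have "t * w' x \<le> 0" "(1 - t) * w' y \<ge> 0" using x y n ends by auto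
  then have "w' x \<le> 0" "w' y \<ge> 0" using t by (auto simp: mult_le_0_iff zero_le_mult_iff)
  moreover have "w' y < w' x"
    by (rule strict_decr_if_deriv_neg[of x y w' w'']) (use x y in \<open>auto intro!: w' neg\<close>)
  ultimately show False by simp
qed

text \<open>The slope is strictly decreasing and, by the condition at 1, nonnegative, hence positive
  on \<open>(0, 1)\<close>. The end point \<open>t = 1\<close> is included because the maximum in
  \<open>mixed_upper\<close> may lie there.\<close>

lemma mixed_concave_pos:
  fixes w w' w'' :: "real \<Rightarrow> real"
  assumes cont: "continuous_on {0..1} w"
    and w: "\<And>s. s \<in> {0<..<1} \<Longrightarrow> (w has_real_derivative w' s) (at s)"
    and w': "\<And>s. s \<in> {0<..<1} \<Longrightarrow> (w' has_real_derivative w'' s) (at s)"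
    and neg: "\<And>s. s \<in> {0<..<1} \<Longrightarrow> w'' s < 0"
    and ends: "0 \<le> w 0" "(w has_real_derivative 0) (at 1 within {0..1})"
    and t: "t \<in> {0<..1}"
  shows "0 < w t"
proof -
  have sdecr: "w' y < w' x" if "0 < x" "x < y" "y < 1" for x y
    by (rule strict_decr_if_deriv_neg[of x y w' w'']) (use that in \<open>auto intro!: w' neg\<close>)
  then have decr: "w' y \<le> w' x" if "0 < x" "x \<le> y" "y < 1" for x y
    using that by (cases "x = y") (auto intro: less_imp_le)
  obtain x where x: "x \<in> {0<..<t}" "w t - w 0 = (t - 0) * w' x"
    using t by (elim mean_value[of 0 t w w', rotated 3])
      (auto intro!: w continuous_on_subset[OF cont])
  \<comment> \<open>Any point between \<open>x\<close> and 1 serves: a nonnegative slope there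
    forces a strictly positive slope at \<open>x\<close>.\<close>
  have "0 \<le> w' ((x + 1) / 2)"
    by (rule deriv_nonneg_if_neumann[OF cont w decr ends(2)]) (use x t in auto)
  also have "\<dots> < w' x" using x t by (intro sdecr) auto
  finally have "0 < t * w' x" using t by simp
  then show ?thesis using x ends by simp
qed

text \<open>With \<open>N\<close> the maximum of \<open>w\<close>, the hypothesis
  \<open>less\<close> makes \<open>-w''\<close> smaller than the constant \<open>8 * N\<close> on
  all of \<open>(0, 1)\<close>, so \<open>w\<close> lies strictly below the parabola with second
  derivative \<open>-8 * N\<close> and zero boundary values. The height of that parabola is
  \<open>N\<close>, which is impossible at the maximum point.\<close>

lemma dirichlet_upper:
  fixes w w' w'' :: "real \<Rightarrow> real"
  assumes cont: "continuous_on {0..1} w"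
    and w: "\<And>s. s \<in> {0<..<1} \<Longrightarrow> (w has_real_derivative w' s) (at s)"
    and w': "\<And>s. s \<in> {0<..<1} \<Longrightarrow> (w' has_real_derivative w'' s) (at s)"
    and ends: "w 0 = 0" "w 1 = 0"
    and less: "\<And>s N. s \<in> {0<..<1} \<Longrightarrow> 0 < N \<Longrightarrow> w s \<le> N \<Longrightarrow> - w'' s < 8 * N"
    and t: "t \<in> {0..1}"
  shows "w t \<le> 0"
proof (rule ccontr)
  assume n: "\<not> w t \<le> 0"
  obtain x where x: "x \<in> {0..1}" "\<And>s. s \<in> {0..1} \<Longrightarrow> w s \<le> w x"
    using continuous_attains_sup[OF _ _ cont] by auto
  define N where "N = w x"
  have N: "0 < N" using x(2)[OF t] n by (simp add: N_def)
  have "x \<noteq> 0" "x \<noteq> 1" using N ends by (auto simp: N_def)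
  then have x01: "x \<in> {0<..<1}" using x by auto
  \<comment> \<open>The parabola is \<open>8 * N\<close> times the integral of \<open>k1 t\<close>
    over \<open>[0, 1]\<close>.\<close>
  have "0 < 4 * N * (x * (1 - x)) - w x"
  proof (rule dirichlet_concave_pos[where w = "\<lambda>t. 4 * N * (t * (1 - t)) - w t"
        and w' = "\<lambda>t. 4 * N * (1 - 2 * t) - w' t" and w'' = "\<lambda>t. - 8 * N - w'' t"])
    fix s :: real assume s: "s \<in> {0<..<1}"
    show "((\<lambda>t. 4 * N * (t * (1 - t)) - w t) has_real_derivative 4 * N * (1 - 2 * s) - w' s) (at s)"
      by (rule derivative_eq_intros w s refl)+ (simp add: algebra_simps)
    show "((\<lambda>t. 4 * N * (1 - 2 * t) - w' t) has_real_derivative - 8 * N - w'' s) (at s)"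
      by (rule derivative_eq_intros w' s refl)+ simp
    show "- 8 * N - w'' s < 0" using less[OF s N] x(2)[of s] s by (auto simp: N_def)
  qed (use x01 ends in \<open>auto intro!: continuous_intros cont\<close>)
  moreover have "4 * N * (x * (1 - x)) \<le> N"
  proof -
    have "N - 4 * N * (x * (1 - x)) = N * (1 - 2 * x)\<^sup>2"
      by (simp add: power2_eq_square algebra_simps)
    then show ?thesis using N by (smt (verit) mult_nonneg_nonneg zero_le_power2)
  qed
  ultimately show False by (simp add: N_def)
qed

text \<open>Same comparison as in \<open>dirichlet_upper\<close>, now with
  \<open>N * (t * (2 - t))\<close>, which is \<open>2 * N\<close> times the integral of
  \<open>k2 t\<close> over \<open>[0, 1]\<close>: it vanishes at 0, has slope 0 at 1 and attains its
  maximum \<open>N\<close> at 1.\<close>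

lemma mixed_upper:
  fixes w w' w'' :: "real \<Rightarrow> real"
  assumes cont: "continuous_on {0..1} w"
    and w: "\<And>s. s \<in> {0<..<1} \<Longrightarrow> (w has_real_derivative w' s) (at s)"
    and w': "\<And>s. s \<in> {0<..<1} \<Longrightarrow> (w' has_real_derivative w'' s) (at s)"
    and ends: "w 0 = 0" "(w has_real_derivative 0) (at 1 within {0..1})"
    and less: "\<And>s N. s \<in> {0<..<1} \<Longrightarrow> 0 < N \<Longrightarrow> w s \<le> N \<Longrightarrow> - w'' s < 2 * N"
    and t: "t \<in> {0..1}"
  shows "w t \<le> 0"
proof (rule ccontr)
  assume n: "\<not> w t \<le> 0"
  obtain x where x: "x \<in> {0..1}" "\<And>s. s \<in> {0..1} \<Longrightarrow> w s \<le> w x"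
    using continuous_attains_sup[OF _ _ cont] by auto
  define N where "N = w x"
  have N: "0 < N" using x(2)[OF t] n by (simp add: N_def)
  have "x \<noteq> 0" using N ends by (auto simp: N_def)
  then have x01: "x \<in> {0<..1}" using x by auto
  have "0 < N * (x * (2 - x)) - w x"
  proof (rule mixed_concave_pos[where w = "\<lambda>t. N * (t * (2 - t)) - w t"
        and w' = "\<lambda>t. N * (2 - 2 * t) - w' t" and w'' = "\<lambda>t. - 2 * N - w'' t"])
    show "((\<lambda>t. N * (t * (2 - t)) - w t) has_real_derivative 0) (at 1 within {0..1})"
      by (rule derivative_eq_intros ends refl)+ simp
    fix s :: real assume s: "s \<in> {0<..<1}"
    show "((\<lambda>t. N * (t * (2 - t)) - w t) has_real_derivative N * (2 - 2 * s) - w' s) (at s)"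
      by (rule derivative_eq_intros w s refl)+ (simp add: algebra_simps)
    show "((\<lambda>t. N * (2 - 2 * t) - w' t) has_real_derivative - 2 * N - w'' s) (at s)"
      by (rule derivative_eq_intros w' s refl)+ simp
    show "- 2 * N - w'' s < 0" using less[OF s N] x(2)[of s] s by (auto simp: N_def)
  qed (use x01 ends in \<open>auto intro!: continuous_intros cont\<close>)
  moreover have "N * (x * (2 - x)) \<le> N"
  proof -
    have "N - N * (x * (2 - x)) = N * (1 - x)\<^sup>2"
      by (simp add: power2_eq_square algebra_simps)
    then show ?thesis using N by (smt (verit) mult_nonneg_nonneg zero_le_power2)
  qed
  ultimately show False by (simp add: N_def)
qed

section \<open>Integrals of the kernels\<close>

text \<open>Closed form of \<open>integral {a..b} (k1 t)\<close> for \<open>t\<close> in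
  \<open>[a, b]\<close>. Outside this interval the integral continues linearly in \<open>t\<close>,
  whereas the polynomial stays quadratic.\<close>

definition quad1 :: "real \<Rightarrow> real \<Rightarrow> real \<Rightarrow> real" where
  "quad1 a b t = t * (a\<^sup>2 / 2 + b - b\<^sup>2 / 2) - t\<^sup>2 / 2 - a\<^sup>2 / 2"

definition quad2 :: "real \<Rightarrow> real \<Rightarrow> real \<Rightarrow> real" where
  "quad2 a b t = t * b - t\<^sup>2 / 2 - a\<^sup>2 / 2"

text \<open>The integral is split at \<open>s = t\<close>. The two branches of the kernel agree
  there, so each can be integrated over its closed interval.\<close>

lemma integral_k1:
  assumes "t \<in> {a..b}"
  shows "integral {a..b} (k1 t) = quad1 a b t"
proof -
  have "((\<lambda>s. s * (1 - t)) has_integral (t\<^sup>2 / 2 * (1 - t) - a\<^sup>2 / 2 * (1 - t))) {a..t}"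
    using assms by (intro fundamental_theorem_of_calculus)
      (auto intro!: derivative_eq_intros simp: has_real_derivative_iff_has_vector_derivative[symmetric])
  then have 1: "(k1 t has_integral (t\<^sup>2 / 2 * (1 - t) - a\<^sup>2 / 2 * (1 - t))) {a..t}"
    by (rule has_integral_eq[rotated]) (simp add: k1_def)
  have "((\<lambda>s. t * (1 - s)) has_integral (t * (b - b\<^sup>2 / 2) - t * (t - t\<^sup>2 / 2))) {t..b}"
    using assms by (intro fundamental_theorem_of_calculus)
      (auto intro!: derivative_eq_intros simp: has_real_derivative_iff_has_vector_derivative[symmetric])
  then have 2: "(k1 t has_integral (t * (b - b\<^sup>2 / 2) - t * (t - t\<^sup>2 / 2))) {t..b}"
    by (rule has_integral_eq[rotated]) (auto simp: k1_def)
  show ?thesis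
    using has_integral_combine[OF _ _ 1 2] assms
    by (auto simp: quad1_def power2_eq_square field_simps dest!: integral_unique)
qed

lemma integral_k2:
  assumes "t \<in> {a..b}"
  shows "integral {a..b} (k2 t) = quad2 a b t"
proof -
  have "((\<lambda>s. s) has_integral (t\<^sup>2 / 2 - a\<^sup>2 / 2)) {a..t}"
    using assms by (intro fundamental_theorem_of_calculus)
      (auto intro!: derivative_eq_intros simp: has_real_derivative_iff_has_vector_derivative[symmetric])
  then have 1: "(k2 t has_integral (t\<^sup>2 / 2 - a\<^sup>2 / 2)) {a..t}"
    by (rule has_integral_eq[rotated]) (simp add: k2_def)
  have "((\<lambda>s. t) has_integral (t * b - t * t)) {t..b}"
    using assms by (intro fundamental_theorem_of_calculus)
      (auto intro!: derivative_eq_intros simp: has_real_derivative_iff_has_vector_derivative[symmetric])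
  then have 2: "(k2 t has_integral (t * b - t * t)) {t..b}"
    by (rule has_integral_eq[rotated]) (auto simp: k2_def)
  show ?thesis
    using has_integral_combine[OF _ _ 1 2] assms
    by (auto simp: quad2_def power2_eq_square field_simps dest!: integral_unique)
qed

section \<open>Values and bounds for the constants \<open>m_const\<close> and
  \<open>M_const\<close>\<close>

lemma m_const_k1: "m_const k1 = 8"
proof -
  have "(SUP t\<in>{0..1}. integral {0..1} (k1 t)) = (SUP t\<in>{0..1}. quad1 0 1 t)"
    by (intro SUP_cong refl integral_k1)
  also have "\<dots> = 1 / 8"
  proof (rule cSup_eq_maximum)
    \<comment> \<open>The maximum is at the midpoint, as completing the square shows below.\<close>
    show "1 / 8 \<in> quad1 0 1 ` {0..1}"
      by (rule image_eqI[of _ _ "1 / 2"]) (auto simp: quad1_def power2_eq_square)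
    fix x assume "x \<in> quad1 0 1 ` {0..1}"
    then obtain t where "x = t / 2 - t\<^sup>2 / 2" by (auto simp: quad1_def)
    then have "1 / 8 - x = (t - 1 / 2)\<^sup>2 / 2" by (simp add: power2_eq_square field_simps)
    then show "x \<le> 1 / 8" by (smt (verit) zero_le_power2 divide_nonneg_nonneg)
  qed
  finally have eq: "(SUP t\<in>{0..1}. integral {0..1} (k1 t)) = 1 / 8" .
  show ?thesis unfolding m_const_def eq by simp
qed

lemma m_const_k2: "m_const k2 = 2"
proof -
  have "(SUP t\<in>{0..1}. integral {0..1} (k2 t)) = (SUP t\<in>{0..1}. quad2 0 1 t)"
    by (intro SUP_cong refl integral_k2)
  also have "\<dots> = 1 / 2"
  proof (rule cSup_eq_maximum)
    show "1 / 2 \<in> quad2 0 1 ` {0..1}"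
      by (rule image_eqI[of _ _ "1"]) (auto simp: quad2_def power2_eq_square)
    fix x assume "x \<in> quad2 0 1 ` {0..1}"
    then obtain t where "x = t - t\<^sup>2 / 2" by (auto simp: quad2_def)
    then have "1 / 2 - x = (t - 1)\<^sup>2 / 2" by (simp add: power2_eq_square field_simps)
    then show "x \<le> 1 / 2" by (smt (verit) zero_le_power2 divide_nonneg_nonneg)
  qed
  finally have eq: "(SUP t\<in>{0..1}. integral {0..1} (k2 t)) = 1 / 2" .
  show ?thesis unfolding m_const_def eq by simp
qed

text \<open>On a compact interval the infimum is attained, so pointwise positivity passes to
  it.\<close>

lemma INF_pos_if_continuous:
  fixes h :: "real \<Rightarrow> real"
  assumes "a \<le> b" "continuous_on {a..b} h" "\<And>t. t \<in> {a..b} \<Longrightarrow> 0 < h t"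
  shows "0 < (INF t\<in>{a..b}. h t)" and "t \<in> {a..b} \<Longrightarrow> (INF t\<in>{a..b}. h t) \<le> h t"
proof -
  obtain x where x: "x \<in> {a..b}" "\<And>s. s \<in> {a..b} \<Longrightarrow> h x \<le> h s"
    using continuous_attains_inf[OF _ _ assms(2)] assms(1) by auto
  have "(INF t\<in>{a..b}. h t) = h x"
    using x by (intro cInf_eq_minimum) auto
  with x assms(3) show "0 < (INF t\<in>{a..b}. h t)"
    and "t \<in> {a..b} \<Longrightarrow> (INF t\<in>{a..b}. h t) \<le> h t" by auto
qed

text \<open>\<open>M_const\<close> is the inverse of a minimum. Positivity of that minimum excludes
  the default value \<open>inverse 0 = 0\<close>; the second claim is what turns a lower bound by
  \<open>M_const k a b * \<mu> * h t\<close> into one by \<open>\<mu>\<close>.\<close>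

lemma M_const_bounds:
  assumes "a \<le> b" "\<And>t. t \<in> {a..b} \<Longrightarrow> integral {a..b} (k t) = h t"
    and "continuous_on {a..b} h" "\<And>t. t \<in> {a..b} \<Longrightarrow> 0 < h t"
  shows "0 < M_const k a b" and "t \<in> {a..b} \<Longrightarrow> 1 \<le> M_const k a b * h t"
proof -
  have *: "(INF t\<in>{a..b}. integral {a..b} (k t)) = (INF t\<in>{a..b}. h t)"
    by (intro INF_cong refl assms(2))
  note inf = INF_pos_if_continuous[OF assms(1,3,4)]
  show "0 < M_const k a b" using inf(1) by (simp add: M_const_def *)
  show "t \<in> {a..b} \<Longrightarrow> 1 \<le> M_const k a b * h t"
    using inf by (simp add: M_const_def * field_simps)
qed

lemma M_const_k1:
  assumes "a < b" "0 < a" "b < 1"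
  shows "0 < M_const k1 a b" and "t \<in> {a..b} \<Longrightarrow> 1 \<le> M_const k1 a b * quad1 a b t"
proof -
  have pos: "0 < quad1 a b t" if t: "t \<in> {a..b}" for t
  proof -
    \<comment> \<open>The summands are the contributions of \<open>s \<le> t\<close> and of
      \<open>s \<ge> t\<close>. The first vanishes only at \<open>a\<close>, the second only at
      \<open>b\<close>.\<close>
    have eq: "quad1 a b t = (1 - t) * ((t - a) * (t + a)) / 2 + t * ((b - t) * (2 - b - t)) / 2"
      by (simp add: quad1_def power2_eq_square field_simps)
    have "0 \<le> (1 - t) * ((t - a) * (t + a))" "0 \<le> t * ((b - t) * (2 - b - t))"
      using t assms by (intro mult_nonneg_nonneg; auto)+
    moreover have "0 < (1 - t) * ((t - a) * (t + a)) \<or> 0 < t * ((b - t) * (2 - b - t))"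
    proof (cases "t = a")
      case True
      then show ?thesis using t assms by (intro disjI2 mult_pos_pos) auto
    next
      case False
      then show ?thesis using t assms by (intro disjI1 mult_pos_pos) auto
    qed
    ultimately show ?thesis unfolding eq by linarith
  qed
  have cont: "continuous_on {a..b} (quad1 a b)"
    unfolding quad1_def[abs_def] by (intro continuous_intros) auto
  show "0 < M_const k1 a b" and "t \<in> {a..b} \<Longrightarrow> 1 \<le> M_const k1 a b * quad1 a b t"
    using M_const_bounds[OF _ integral_k1 cont pos] assms by auto
qed

text \<open>The bound is stated at \<open>t = a\<close> only, where \<open>quad2\<close> equals
  \<open>a * (b - a)\<close>: with the Neumann condition the solutions are nondecreasing, so their
  minimum over \<open>[a, b]\<close> is at \<open>a\<close>.\<close>

lemma M_const_k2:
  assumes "a < b" "0 < a"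
  shows "0 < M_const k2 a b" and "1 \<le> M_const k2 a b * (a * (b - a))"
proof -
  have pos: "0 < quad2 a b t" if t: "t \<in> {a..b}" for t
  proof -
    have eq: "quad2 a b t = (t - a) * (t + a) / 2 + t * (b - t)"
      by (simp add: quad2_def power2_eq_square field_simps)
    have "0 \<le> (t - a) * (t + a)" "0 \<le> t * (b - t)"
      using t assms by (intro mult_nonneg_nonneg; auto)+
    moreover have "0 < (t - a) * (t + a) \<or> 0 < t * (b - t)"
    proof (cases "t = a")
      case True
      then show ?thesis using t assms by (intro disjI2 mult_pos_pos) auto
    next
      case False
      then show ?thesis using t assms by (intro disjI1 mult_pos_pos) auto
    qed
    ultimately show ?thesis unfolding eq by linarith
  qed
  have cont: "continuous_on {a..b} (quad2 a b)"
    unfolding quad2_def[abs_def] by (intro continuous_intros) auto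
  have "quad2 a b a = a * (b - a)" by (simp add: quad2_def power2_eq_square field_simps)
  then show "0 < M_const k2 a b" and "1 \<le> M_const k2 a b * (a * (b - a))"
    using M_const_bounds(1)[OF _ integral_k2 cont pos]
      M_const_bounds(2)[OF _ integral_k2 cont pos, where t = a] assms by auto
qed

section \<open>Lower bounds\<close>

text \<open>Suppose \<open>\<phi> = w - \<kappa> * quad1 a b\<close> is nonpositive at
  \<open>t\<close>. Concavity of \<open>w\<close> outside \<open>[a, b]\<close> yields one
  inequality between \<open>\<phi>\<close> and \<open>\<phi>'\<close> at each of \<open>a\<close>
  and \<open>b\<close>. Combined with the strict decrease of \<open>\<phi>'\<close> on
  \<open>[a, b]\<close>, they give \<open>\<phi>' t\<close> contradictory signs.\<close>

lemma dirichlet_lower: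
  fixes w w' w'' :: "real \<Rightarrow> real"
  assumes cont: "continuous_on {0..1} w"
    and w: "\<And>s. s \<in> {0<..<1} \<Longrightarrow> (w has_real_derivative w' s) (at s)"
    and w': "\<And>s. s \<in> {0<..<1} \<Longrightarrow> (w' has_real_derivative w'' s) (at s)"
    and nonpos: "\<And>s. s \<in> {0<..<1} \<Longrightarrow> w'' s \<le> 0"
    and ends: "0 \<le> w 0" "0 \<le> w 1"
    and ab: "0 < a" "a < b" "b < 1"
    and neg: "\<And>s. s \<in> {a..b} \<Longrightarrow> w'' s < - \<kappa>"
    and t: "t \<in> {a..b}"
  shows "\<kappa> * quad1 a b t < w t"
proof (rule ccontr)
  define \<phi> where "\<phi> s = w s - \<kappa> * quad1 a b s" for s
  define \<phi>' where "\<phi>' s = w' s - \<kappa> * (a\<^sup>2 / 2 + b - b\<^sup>2 / 2 - s)" for s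
  assume "\<not> \<kappa> * quad1 a b t < w t"
  then have n: "\<phi> t \<le> 0" by (simp add: \<phi>_def)
  have d: "(\<phi> has_real_derivative \<phi>' s) (at s)" if "s \<in> {0<..<1}" for s
    unfolding \<phi>_def quad1_def \<phi>'_def
    by (auto intro!: derivative_eq_intros w that)
  have d': "(\<phi>' has_real_derivative w'' s + \<kappa>) (at s)" if "s \<in> {0<..<1}" for s
    unfolding \<phi>'_def by (rule derivative_eq_intros w' that refl)+ simp
  have contp: "continuous_on {0..1} \<phi>"
    unfolding \<phi>_def quad1_def by (intro continuous_intros cont) auto
  have neg': "w'' s + \<kappa> < 0" if "s \<in> {a..b}" for s
    using neg[OF that] by simp
  have sdecr: "\<phi>' y < \<phi>' x" if "a \<le> x" "x < y" "y \<le> b" for x y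
    by (rule strict_decr_if_deriv_neg[of x y \<phi>' "\<lambda>s. w'' s + \<kappa>"])
      (use that ab in \<open>auto intro!: d' neg'\<close>)
  have decr: "w' y \<le> w' x" if "0 < x" "x \<le> y" "y < 1" for x y
    by (rule decr_if_deriv_nonpos[of x y w' w'']) (use that in \<open>auto intro!: w' nonpos\<close>)
  \<comment> \<open>The tangent of \<open>w\<close> at \<open>a\<close> is nonnegative at 0, by
    concavity and \<open>0 \<le> w 0\<close>. The tangent of \<open>quad1\<close> at
    \<open>a\<close> passes through 0 there, because it is the linear continuation of the kernel
    integral.\<close>
  have a: "a * \<phi>' a \<le> \<phi> a"
  proof -
    obtain x where x: "x \<in> {0<..<a}" "w a - w 0 = (a - 0) * w' x"
      using ab by (elim mean_value[of 0 a w w', rotated 3])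
        (auto intro!: w continuous_on_subset[OF cont])
    have "a * w' a \<le> a * w' x" using x ab by (intro mult_left_mono decr) auto
    then have "a * w' a \<le> w a"
      using x(2) ends unfolding diff_0_right by linarith
    then show ?thesis
      by (simp add: \<phi>_def \<phi>'_def quad1_def power2_eq_square algebra_simps)
  qed
  \<comment> \<open>The mirror image at \<open>b\<close>: the tangent of \<open>quad1\<close> at
    \<open>b\<close> vanishes at 1.\<close>
  have b: "- \<phi> b \<le> (1 - b) * \<phi>' b"
  proof -
    obtain x where x: "x \<in> {b<..<1}" "w 1 - w b = (1 - b) * w' x"
      using ab by (elim mean_value[of b 1 w w', rotated 3])
        (auto intro!: w continuous_on_subset[OF cont])
    have "(1 - b) * w' x \<le> (1 - b) * w' b" using x ab by (intro mult_left_mono decr) auto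
    then have "- w b \<le> (1 - b) * w' b" using x(2) ends by linarith
    moreover have "\<kappa> * quad1 a b b + (1 - b) * (\<kappa> * (a\<^sup>2 / 2 + b - b\<^sup>2 / 2 - b)) = 0"
      by (simp add: quad1_def power2_eq_square field_simps)
    ultimately show ?thesis by (simp add: \<phi>_def \<phi>'_def right_diff_distrib)
  qed
  \<comment> \<open>For \<open>a < t\<close>, splitting \<open>t = (t - a) + a\<close> gives
    \<open>t * \<phi>' t < (\<phi> t - \<phi> a) + \<phi> a \<le> 0\<close>; for
    \<open>t = a\<close> the inequality at \<open>a\<close> suffices. The other side uses
    \<open>1 - t = (b - t) + (1 - b)\<close>.\<close>
  have left: "\<phi>' t \<le> 0 \<and> (a < t \<longrightarrow> \<phi>' t < 0)"
  proof (cases "a < t")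
    case True
    obtain x where x: "x \<in> {a<..<t}" "\<phi> t - \<phi> a = (t - a) * \<phi>' x"
      using True ab t by (elim mean_value[of a t \<phi> \<phi>', rotated 3])
        (auto intro!: d continuous_on_subset[OF contp])
    have "(t - a) * \<phi>' t < (t - a) * \<phi>' x" "a * \<phi>' t < a * \<phi>' a"
      using sdecr[of x t] sdecr[of a t] x True t ab by auto
    then have "t * \<phi>' t < 0" using x a n by (simp add: algebra_simps)
    then show ?thesis using t ab by (auto simp: mult_less_0_iff)
  next
    case False
    then have "t = a" using t by auto
    then show ?thesis using a n ab by (smt (verit) mult_pos_pos)
  qed
  have right: "\<phi>' t \<ge> 0 \<and> (t < b \<longrightarrow> \<phi>' t > 0)"
  proof (cases "t < b")
    case True
    obtain x where x: "x \<in> {t<..<b}" "\<phi> b - \<phi> t = (b - t) * \<phi>' x"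
      using True ab t by (elim mean_value[of t b \<phi> \<phi>', rotated 3])
        (auto intro!: d continuous_on_subset[OF contp])
    have "(b - t) * \<phi>' x < (b - t) * \<phi>' t" "(1 - b) * \<phi>' b < (1 - b) * \<phi>' t"
      using sdecr[of t x] sdecr[of t b] x True t ab by auto
    then have "0 < (1 - t) * \<phi>' t" using x b n by (simp add: algebra_simps)
    then show ?thesis using t ab by (auto simp: zero_less_mult_iff)
  next
    case False
    then have "t = b" using t by auto
    then show ?thesis using b n ab by (smt (verit) mult_pos_neg)
  qed
  \<comment> \<open>Since \<open>a < b\<close>, the point \<open>t\<close> differs from one of the
    end points, so one of the two signs is strict.\<close>
  show False using left right ab t by force
qed

text \<open>\<open>\<psi>\<close> is the derivative of \<open>w - \<kappa> * quad2 a b\<close>. It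
  decreases strictly on \<open>[a, b)\<close> and cannot approach a negative limit at
  \<open>b\<close>, since \<open>w'\<close> is nonnegative. Hence
  \<open>w' a > \<kappa> * (b - a)\<close>, and concavity on \<open>[0, a]\<close> gives
  \<open>w a \<ge> a * w' a\<close>. The half-open interval allows \<open>b = 1\<close>, where
  \<open>w'\<close> is not controlled.\<close>

lemma mixed_lower:
  fixes w w' w'' :: "real \<Rightarrow> real"
  assumes cont: "continuous_on {0..1} w"
    and w: "\<And>s. s \<in> {0<..<1} \<Longrightarrow> (w has_real_derivative w' s) (at s)"
    and w': "\<And>s. s \<in> {0<..<1} \<Longrightarrow> (w' has_real_derivative w'' s) (at s)"
    and nonneg: "\<And>s. s \<in> {0<..<1} \<Longrightarrow> 0 \<le> w' s"
    and decr: "\<And>x y. 0 < x \<Longrightarrow> x \<le> y \<Longrightarrow> y < 1 \<Longrightarrow> w' y \<le> w' x"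
    and end0: "0 \<le> w 0"
    and ab: "0 < a" "a < b" "b \<le> 1"
    and neg: "\<And>s. s \<in> {a..<b} \<Longrightarrow> w'' s < - \<kappa>"
  shows "\<kappa> * (a * (b - a)) < w a"
proof -
  define \<psi> where "\<psi> s = w' s - \<kappa> * (b - s)" for s
  have d: "(\<psi> has_real_derivative w'' s + \<kappa>) (at s)" if "s \<in> {0<..<1}" for s
    unfolding \<psi>_def by (rule derivative_eq_intros w' that refl)+ simp
  have neg': "w'' s + \<kappa> < 0" if "s \<in> {a..<b}" for s
    using neg[OF that] by simp
  have sdecr: "\<psi> y < \<psi> x" if "a \<le> x" "x < y" "y < b" for x y
    by (rule strict_decr_if_deriv_neg[of x y \<psi> "\<lambda>s. w'' s + \<kappa>"])
      (use that ab in \<open>auto intro!: d neg'\<close>)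
  \<comment> \<open>The limit at \<open>b\<close> yields only a weak inequality at \<open>c\<close>;
    moving from \<open>c\<close> back to \<open>a\<close> makes it strict.\<close>
  define c where "c = (a + b) / 2"
  have c: "a < c" "c < b" using ab by (auto simp: c_def)
  have "((\<lambda>s. - \<kappa> * (b - s)) \<longlongrightarrow> - \<kappa> * (b - b)) (at_left b)"
    by (intro tendsto_intros)
  moreover have "\<forall>\<^sub>F s in at_left b. - \<kappa> * (b - s) \<le> \<psi> c"
    using eventually_at_left_real[OF c(2)]
  proof eventually_elim
    case (elim s)
    have "0 \<le> w' s" using elim c ab by (intro nonneg) auto
    then have "- \<kappa> * (b - s) \<le> \<psi> s" by (simp add: \<psi>_def)
    then show ?case using sdecr[of c s] elim c by simp
  qed
  ultimately have "- \<kappa> * (b - b) \<le> \<psi> c"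
    by (rule tendsto_upperbound) simp
  then have "0 < \<psi> a" using sdecr[of a c] c by simp
  then have *: "a * (\<kappa> * (b - a)) < a * w' a" using ab by (simp add: \<psi>_def)
  obtain x where x: "x \<in> {0<..<a}" "w a - w 0 = (a - 0) * w' x"
    using ab by (elim mean_value[of 0 a w w', rotated 3])
      (auto intro!: w continuous_on_subset[OF cont])
  have "a * w' a \<le> a * w' x" using x ab by (intro mult_left_mono decr) auto
  with * have "a * (\<kappa> * (b - a)) < w a"
    using x(2) end0 unfolding diff_0_right by linarith
  then show ?thesis by (simp add: mult.left_commute)
qed

text \<open>\<open>dirichlet_lower\<close> is applied with
  \<open>\<kappa> = M_const k1 a b * w t\<close>, where \<open>t\<close> is a minimum point of
  \<open>w\<close> on \<open>[a, b]\<close>. By the choice of \<open>M_const\<close> the resulting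
  bound at \<open>t\<close> reads \<open>w t < w t\<close>.\<close>

lemma dirichlet_lower_contra:
  fixes w w' w'' :: "real \<Rightarrow> real"
  assumes cont: "continuous_on {0..1} w"
    and w: "\<And>s. s \<in> {0<..<1} \<Longrightarrow> (w has_real_derivative w' s) (at s)"
    and w': "\<And>s. s \<in> {0<..<1} \<Longrightarrow> (w' has_real_derivative w'' s) (at s)"
    and nonpos: "\<And>s. s \<in> {0<..<1} \<Longrightarrow> w'' s \<le> 0"
    and ends: "0 \<le> w 0" "0 \<le> w 1"
    and ab: "0 < a" "a < b" "b < 1"
    and pos: "\<And>s. s \<in> {a..b} \<Longrightarrow> 0 < w s"
    and neg: "\<And>s. s \<in> {a..b} \<Longrightarrow> M_const k1 a b * w s < - w'' s"
  shows False
proof -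
  note M = M_const_k1[OF ab(2,1,3)]
  have "continuous_on {a..b} w" using ab by (intro continuous_on_subset[OF cont]) auto
  then obtain t where t: "t \<in> {a..b}" "\<And>s. s \<in> {a..b} \<Longrightarrow> w t \<le> w s"
    using continuous_attains_inf[of "{a..b}" w] ab by auto
  have "M_const k1 a b * w t * quad1 a b t < w t"
  proof (rule dirichlet_lower[OF cont w w' nonpos ends ab])
    fix s assume s: "s \<in> {a..b}"
    have "M_const k1 a b * w t \<le> M_const k1 a b * w s"
      using M(1) t(2)[OF s] by (intro mult_left_mono) auto
    then show "w'' s < - (M_const k1 a b * w t)" using neg[OF s] by linarith
  qed (use t in auto)
  moreover have "w t * 1 \<le> w t * (M_const k1 a b * quad1 a b t)"
    using M(2)[OF t(1)] pos[OF t(1)] by (intro mult_left_mono) auto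
  ultimately show False by (simp add: mult_ac)
qed

text \<open>Concavity and the Neumann condition make \<open>w\<close> nondecreasing, so its minimum
  over \<open>[a, b)\<close> is \<open>w a\<close>. Then \<open>mixed_lower\<close> with
  \<open>\<kappa> = M_const k2 a b * w a\<close> gives \<open>w a < w a\<close>.\<close>

lemma mixed_lower_contra:
  fixes w w' w'' :: "real \<Rightarrow> real"
  assumes cont: "continuous_on {0..1} w"
    and w: "\<And>s. s \<in> {0<..<1} \<Longrightarrow> (w has_real_derivative w' s) (at s)"
    and w': "\<And>s. s \<in> {0<..<1} \<Longrightarrow> (w' has_real_derivative w'' s) (at s)"
    and nonpos: "\<And>s. s \<in> {0<..<1} \<Longrightarrow> w'' s \<le> 0"
    and ends: "0 \<le> w 0" "(w has_real_derivative 0) (at 1 within {0..1})"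
    and ab: "0 < a" "a < b" "b \<le> 1"
    and pos: "0 < w a"
    and neg: "\<And>s. s \<in> {a..<b} \<Longrightarrow> M_const k2 a b * w s < - w'' s"
  shows False
proof -
  note M = M_const_k2[OF ab(2,1)]
  have decr: "w' y \<le> w' x" if "0 < x" "x \<le> y" "y < 1" for x y
    by (rule decr_if_deriv_nonpos[of x y w' w'']) (use that in \<open>auto intro!: w' nonpos\<close>)
  have nonneg: "0 \<le> w' s" if "s \<in> {0<..<1}" for s
    by (rule deriv_nonneg_if_neumann[OF cont w decr ends(2) that])
  have "M_const k2 a b * w a * (a * (b - a)) < w a"
  proof (rule mixed_lower[OF cont w w' nonneg decr ends(1) ab])
    fix s assume s: "s \<in> {a..<b}"
    have "w a \<le> w s"
    proof (rule DERIV_nonneg_imp_nondecreasing[where f = w])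
      fix x assume "a \<le> x" "x \<le> s"
      then show "\<exists>y. (w has_real_derivative y) (at x) \<and> 0 \<le> y"
        using w[of x] nonneg[of x] ab s by auto
    qed (use s in auto)
    then have "M_const k2 a b * w a \<le> M_const k2 a b * w s"
      using M(1) by (intro mult_left_mono) auto
    then show "w'' s < - (M_const k2 a b * w a)" using neg[OF s] by linarith
  qed
  moreover have "w a * 1 \<le> w a * (M_const k2 a b * (a * (b - a)))"
    using M(2) pos by (intro mult_left_mono) auto
  ultimately show False by (simp add: mult_ac)
qed

section \<open>The change of variable\<close>

text \<open>The expression interpolates linearly between \<open>R1 ^ k\<close> at 0 and
  \<open>R0 ^ k\<close> at 1. With \<open>k = n - 2\<close> it is the denominator in
  \<open>p_of\<close> and, after simplification, in \<open>r_of\<close>.\<close>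

lemma radial_denominator_bounds:
  fixes R0 R1 :: real
  assumes "0 < R0" "R0 < R1" "t \<in> {0..1}"
  shows "R0 ^ k \<le> R1 ^ k - (R1 ^ k - R0 ^ k) * t" "R1 ^ k - (R1 ^ k - R0 ^ k) * t \<le> R1 ^ k"
proof -
  have "R0 ^ k \<le> R1 ^ k" using assms by (intro power_mono) auto
  then show "R1 ^ k - (R1 ^ k - R0 ^ k) * t \<le> R1 ^ k" using assms by simp
  have "(R1 ^ k - R0 ^ k) * t \<le> (R1 ^ k - R0 ^ k) * 1"
    using \<open>R0 ^ k \<le> R1 ^ k\<close> assms by (intro mult_left_mono) auto
  then show "R0 ^ k \<le> R1 ^ k - (R1 ^ k - R0 ^ k) * t" by simp
qed

text \<open>For \<open>n = 2\<close> the value is a weighted geometric mean of the radii. For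
  \<open>n \<ge> 3\<close> its power of exponent \<open>k = n - 2\<close> is
  \<open>R0 ^ k * R1 ^ k / d\<close> with \<open>d\<close> between \<open>R0 ^ k\<close> and
  \<open>R1 ^ k\<close>.\<close>

lemma r_of_mem:
  assumes "2 \<le> n" "0 < R0" "R0 < R1" and t: "t \<in> {0..1}"
  shows "r_of n R0 R1 t \<in> {R0..R1}"
proof (cases "n = 2")
  case True
  have "R0 powr (1 - t) * R0 powr t \<le> R1 powr (1 - t) * R0 powr t"
    "R1 powr (1 - t) * R0 powr t \<le> R1 powr (1 - t) * R1 powr t"
    using assms by (auto intro!: mult_right_mono mult_left_mono powr_mono2)
  then show ?thesis using True assms by (simp add: r_of_def flip: powr_add)
next
  case False
  define k where "k = n - 2"
  have k: "0 < k" "real n - 2 = real k" using False assms by (auto simp: k_def)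
  define d where "d = R1 ^ k - (R1 ^ k - R0 ^ k) * t"
  have lt: "R0 ^ k < R1 ^ k" using assms k by (intro power_strict_mono) auto
  have R0k: "0 < R0 ^ k" "0 < R1 ^ k" using assms by auto
  have d: "R0 ^ k \<le> d" "d \<le> R1 ^ k"
    using radial_denominator_bounds[OF assms(2-4)] by (auto simp: d_def)
  have "coef_B n R0 R1 - t = d / (R1 ^ k - R0 ^ k)"
    using lt by (simp add: coef_B_def d_def k_def[symmetric] field_simps)
  then have eq: "coef_A n R0 R1 / (coef_B n R0 R1 - t) = (R0 ^ k * R1 ^ k) / d"
    using lt d R0k by (simp add: coef_A_def k_def[symmetric] power_mult_distrib)
  have root: "(x ^ k) powr (1 / real k) = x" if "0 < x" for x :: real
    using that k by (simp add: powr_realpow[symmetric] powr_powr)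
  have "R0 ^ k \<le> (R0 ^ k * R1 ^ k) / d" "(R0 ^ k * R1 ^ k) / d \<le> R1 ^ k"
    using d R0k by (auto simp: field_simps)
  then have "(R0 ^ k) powr (1 / real k) \<le> ((R0 ^ k * R1 ^ k) / d) powr (1 / real k)"
    "((R0 ^ k * R1 ^ k) / d) powr (1 / real k) \<le> (R1 ^ k) powr (1 / real k)"
    using R0k d by (auto intro!: powr_mono2)
  then show ?thesis using False assms root k eq by (simp add: r_of_def)
qed

lemma p_of_pos:
  assumes "2 \<le> n" "0 < R0" "R0 < R1" and t: "t \<in> {0..1}"
  shows "0 < p_of n R0 R1 t"
proof (cases "n = 2")
  case True
  have "0 < r_of n R0 R1 t" using r_of_mem[OF assms] assms by auto
  moreover have "ln (R1 / R0) \<noteq> 0" using assms by simp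
  ultimately show ?thesis using True by (simp add: p_of_def)
next
  case False
  then have "R0 ^ (n - 2) < R1 ^ (n - 2)" using assms by (intro power_strict_mono) auto
  moreover have "0 < R1 ^ (n - 2) - (R1 ^ (n - 2) - R0 ^ (n - 2)) * t"
    using radial_denominator_bounds(1)[OF assms(2-4), of "n - 2"] assms
    by (smt (verit) zero_less_power)
  moreover have "real n - 2 \<noteq> 0" using False by auto
  ultimately show ?thesis using False assms by (simp add: p_of_def)
qed

lemma continuous_on_p_of:
  assumes "2 \<le> n" "0 < R0" "R0 < R1"
  shows "continuous_on {0..1} (p_of n R0 R1)"
proof (cases "n = 2")
  case True
  then show ?thesis unfolding p_of_def[abs_def] r_of_def[abs_def] using assms
    by (auto intro!: continuous_intros)
next
  case False
  have "0 < R1 ^ (n - 2) - (R1 ^ (n - 2) - R0 ^ (n - 2)) * t" if "t \<in> {0..1}" for t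
    using radial_denominator_bounds(1)[OF assms(2,3) that, of "n - 2"] assms
    by (smt (verit) zero_less_power)
  then show ?thesis unfolding p_of_def[abs_def] using False
    by (auto intro!: continuous_intros simp: less_imp_neq[symmetric] less_imp_neq)
qed

lemma p_of_le_SUP:
  assumes "2 \<le> n" "0 < R0" "R0 < R1" "t \<in> {0..1}"
  shows "p_of n R0 R1 t \<le> (SUP t\<in>{0..1}. p_of n R0 R1 t)"
  using assms
  by (intro cSUP_upper bounded_imp_bdd_above compact_imp_bounded compact_continuous_image
      continuous_on_p_of) auto

section \<open>The cone\<close>

lemma sup_norm_ge:
  assumes "continuous_on {0..1} w" "t \<in> {0..1}"
  shows "\<bar>w t\<bar> \<le> sup_norm w"
  unfolding sup_norm_def using assms
  by (intro cSUP_upper bounded_imp_bdd_above compact_imp_bounded compact_continuous_image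
      continuous_intros) auto

lemma cone_nonneg: "w \<in> cone \<omega> a b c \<Longrightarrow> t \<in> {0..1} \<Longrightarrow> 0 \<le> w t"
  by (simp add: cone_def)

text \<open>A nonzero value makes \<open>sup_norm w\<close> positive, and the Harnack-type
  inequality in the cone carries this to all of \<open>[a, b]\<close>.\<close>

lemma cone_pos:
  assumes w: "w \<in> cone \<omega> a b c" and "0 < c" and ab: "{a..b} \<subseteq> {0..1}"
    and t: "t \<in> {0..1}" "w t \<noteq> 0" and s: "s \<in> {a..b}"
  shows "0 < w s"
proof -
  have "0 < \<bar>w t\<bar>" using t by simp
  also have "\<bar>w t\<bar> \<le> sup_norm w"
    using w t by (intro sup_norm_ge) (auto simp: cone_def weighted_C1_def)
  finally have "0 < c * sup_norm w" using \<open>0 < c\<close> by simp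
  also have "\<dots> \<le> (INF t\<in>{a..b}. w t)" using w by (simp add: cone_def)
  also have "\<dots> \<le> w s"
  proof (rule cINF_lower[OF _ s])
    show "bdd_below (w ` {a..b})"
      using cone_nonneg[OF w] ab by (intro bdd_belowI[of _ 0]) auto
  qed
  finally show ?thesis .
qed

text \<open>\<open>w\<close> is known to vanish on \<open>[0, 1]\<close> only, but the derivative at
  an interior point depends only on nearby values, so it vanishes as well.\<close>

lemma weighted_norm_zero:
  assumes w: "w \<in> cone \<omega> a b c" and z: "\<And>t. t \<in> {0..1} \<Longrightarrow> w t = 0"
  shows "weighted_norm \<omega> w = 0"
proof -
  have "sup_norm w = (SUP t\<in>{0..1::real}. 0)"
    unfolding sup_norm_def using z by (intro SUP_cong) auto
  then have "sup_norm w = 0" by simp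
  moreover have "deriv_norm \<omega> w = 0"
  proof -
    have "deriv w t = 0" if "t \<in> {0<..<1}" for t
    proof (rule DERIV_imp_deriv)
      show "(w has_real_derivative 0) (at t)"
        by (rule has_field_derivative_transform_within_open[where f = "\<lambda>_. 0" and S = "{0<..<1}"])
          (use that z in auto)
    qed
    then have "deriv_norm \<omega> w = (SUP t\<in>{0<..<1::real}. 0)"
      unfolding deriv_norm_def by (intro SUP_cong) auto
    then show ?thesis by simp
  qed
  ultimately show ?thesis by (simp add: weighted_norm_def)
qed

section \<open>The nonlinearities\<close>

text \<open>Let \<open>x\<close> tend to 0 from the right. This extends condition (i), which
  concerns positive arguments only, to points where a component vanishes.\<close>

lemma nonpos_at_zero:
  fixes h :: "real \<Rightarrow> real"
  assumes "continuous_on {0..} h" "\<And>x. 0 < x \<Longrightarrow> h x < C * x"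
  shows "h 0 \<le> 0"
proof -
  have "(h \<longlongrightarrow> h 0) (at_right 0)"
    using assms(1) by (auto simp: continuous_on_def intro: tendsto_within_subset)
  moreover have "((\<lambda>x. C * x) \<longlongrightarrow> C * 0) (at_right 0)" by (intro tendsto_intros)
  moreover have "\<forall>\<^sub>F x in at_right 0. h x \<le> C * x"
    using assms(2) by (intro eventually_at_rightI[of 0 1]) (auto intro: less_imp_le)
  ultimately have "h 0 \<le> C * 0" by (intro tendsto_le[of "at_right 0"]) auto
  then show ?thesis by simp
qed

lemma admissible_nonneg:
  assumes "admissible_nonlin R0 R1 f" "r \<in> {R0..R1}" "0 \<le> w1" "0 \<le> w2" "0 \<le> z1" "0 \<le> z2"
  shows "0 \<le> f r w1 w2 z1 z2"
  using assms by (simp add: admissible_nonlin_def)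

lemma admissible_continuous_args:
  assumes "admissible_nonlin R0 R1 f" "r \<in> {R0..R1}" "0 \<le> z1" "0 \<le> z2"
  shows "0 \<le> w2 \<Longrightarrow> continuous_on {0..} (\<lambda>w1. f r w1 w2 z1 z2)"
    and "0 \<le> w1 \<Longrightarrow> continuous_on {0..} (\<lambda>w2. f r w1 w2 z1 z2)"
proof -
  have c: "continuous_on ({R0..R1} \<times> {0..} \<times> {0..} \<times> {0..} \<times> {0..})
      (\<lambda>(r, w1, w2, z1, z2). f r w1 w2 z1 z2)"
    using assms by (simp add: admissible_nonlin_def)
  show "continuous_on {0..} (\<lambda>w1. f r w1 w2 z1 z2)" if "0 \<le> w2"
  proof -
    have "continuous_on {0..}
        (\<lambda>w1. case (r, w1, w2, z1, z2) of (r, w1, w2, z1, z2) \<Rightarrow> f r w1 w2 z1 z2)"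
      by (rule continuous_on_compose2[OF c, where f = "\<lambda>w1. (r, w1, w2, z1, z2)"])
        (use assms that in \<open>auto intro!: continuous_intros\<close>)
    then show ?thesis by simp
  qed
  show "continuous_on {0..} (\<lambda>w2. f r w1 w2 z1 z2)" if "0 \<le> w1"
  proof -
    have "continuous_on {0..}
        (\<lambda>w2. case (r, w1, w2, z1, z2) of (r, w1, w2, z1, z2) \<Rightarrow> f r w1 w2 z1 z2)"
      by (rule continuous_on_compose2[OF c, where f = "\<lambda>w2. (r, w1, w2, z1, z2)"])
        (use assms that in \<open>auto intro!: continuous_intros\<close>)
    then show ?thesis by simp
  qed
qed

text \<open>Dividing by the supremum \<open>S\<close> in condition (i) absorbs the weight, since
  \<open>p / S \<le> 1\<close>. The result has the form of the hypothesis \<open>less\<close> in the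
  upper comparison.\<close>

lemma scaled_upper:
  fixes p S q m w N :: real
  assumes "0 < p" "p \<le> S" "0 < m" "0 < N" "0 \<le> w" "w \<le> N"
    and "0 < w \<Longrightarrow> q < m / S * w" and "w = 0 \<Longrightarrow> q \<le> 0"
  shows "p * q < m * N"
proof (cases "w = 0")
  case True
  then have "p * q \<le> 0" using assms by (auto intro: mult_nonneg_nonpos)
  then show ?thesis using assms by (smt (verit) mult_pos_pos)
next
  case False
  have "p * q < p * (m / S * w)" using assms False by (intro mult_strict_left_mono) auto
  also have "\<dots> = (p / S) * (m * w)" by simp
  also have "\<dots> \<le> 1 * (m * w)" using assms by (intro mult_right_mono) auto
  also have "\<dots> \<le> m * N" using assms by simp
  finally show ?thesis .
qed

text \<open>Here \<open>S\<close> is the infimum of the weight in condition (ii), so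
  \<open>p / S \<ge> 1\<close>.\<close>

lemma scaled_lower:
  fixes p S q M w :: real
  assumes "0 < S" "S \<le> p" "0 < M" "0 < w" "M / S * w < q"
  shows "M * w < p * q"
proof -
  have "1 * (M * w) \<le> (p / S) * (M * w)" using assms by (intro mult_right_mono) auto
  also have "\<dots> = p * (M / S * w)" by simp
  also have "\<dots> < p * q" using assms by (intro mult_strict_left_mono) auto
  finally show ?thesis by simp
qed

section \<open>Nonexistence of positive radial solutions of the system\<close>

theorem theorem3p4:
  fixes n :: nat and R0 R1 a1 b1 a2 b2 :: real and f1 f2 :: nonlin
  assumes n: "n \<ge> 2"
    and R: "0 < R0" "R0 < R1"
    and f: "admissible_nonlin R0 R1 f1" "admissible_nonlin R0 R1 f2"
    and ab1: "a1 < b1" "{a1..b1} \<subseteq> {0<..<1}"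
    and ab2: "a2 < b2" "{a2..b2} \<subseteq> {0<..1}"
    and cond:
      "(\<forall>r\<in>{R0..R1}. \<forall>w1\<ge>0. \<forall>w2\<ge>0. \<forall>z1\<ge>0. \<forall>z2\<ge>0.
          (w1 > 0 \<longrightarrow> f1 r w1 w2 z1 z2 < m_const k1 / (SUP t\<in>{0..1}. p_of n R0 R1 t) * w1) \<and>
          (w2 > 0 \<longrightarrow> f2 r w1 w2 z1 z2 < m_const k2 / (SUP t\<in>{0..1}. p_of n R0 R1 t) * w2))
       \<or>
       (\<forall>r\<in>{R0..R1}. \<forall>w1\<ge>0. \<forall>w2\<ge>0. \<forall>z1\<ge>0. \<forall>z2\<ge>0.
          (w1 > 0 \<longrightarrow> f1 r w1 w2 z1 z2 > M_const k1 a1 b1 / (INF t\<in>{a1..b1}. p_of n R0 R1 t) * w1) \<and>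
          (w2 > 0 \<longrightarrow> f2 r w1 w2 z1 z2 > M_const k2 a2 b2 / (INF t\<in>{a2..b2}. p_of n R0 R1 t) * w2))"
  shows "\<not> (\<exists>u v. positive_radial_solution n R0 R1 f1 f2 a1 b1 a2 b2 u v) \<and>
    (\<forall>u v. (u, v) \<in> cone_K a1 b1 a2 b2 \<and> radial_solution n R0 R1 f1 f2 u v \<longrightarrow>
      (\<forall>t\<in>{0..1}. u t = 0 \<and> v t = 0))"
proof -
  have ab1': "0 < a1" "b1 < 1" using ab1(1) subsetD[OF ab1(2), of a1] subsetD[OF ab1(2), of b1] by auto
  have ab2': "0 < a2" "b2 \<le> 1" using ab2(1) subsetD[OF ab2(2), of a2] subsetD[OF ab2(2), of b2] by auto
  have zero: "\<forall>t\<in>{0..1}. u t = 0 \<and> v t = 0"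
    if K: "(u, v) \<in> cone_K a1 b1 a2 b2" and sol: "radial_solution n R0 R1 f1 f2 u v" for u v
  proof -
    have uK: "u \<in> cone omega1 a1 b1 (min a1 (1 - b1))" and vK: "v \<in> cone omega2 a2 b2 a2"
      using K by (auto simp: cone_K_def)
    have cu: "continuous_on {0..1} u" and cv: "continuous_on {0..1} v"
      and bc: "u 0 = 0" "u 1 = 0" "v 0 = 0" "(v has_real_derivative 0) (at 1 within {0..1})"
      using sol by (auto simp: radial_solution_def)
    have du: "(u has_real_derivative deriv u t) (at t)"
      and dv: "(v has_real_derivative deriv v t) (at t)"
      and ddu: "(deriv u has_real_derivative deriv (deriv u) t) (at t)"
      and ddv: "(deriv v has_real_derivative deriv (deriv v) t) (at t)"
      if "t \<in> {0<..<1}" for t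
      using sol that by (auto simp: radial_solution_def DERIV_deriv_iff_real_differentiable)
    define y1 where "y1 t = \<bar>deriv u t\<bar> / \<bar>deriv (r_of n R0 R1) t\<bar>" for t
    define y2 where "y2 t = \<bar>deriv v t\<bar> / \<bar>deriv (r_of n R0 R1) t\<bar>" for t
    let ?r = "r_of n R0 R1" and ?p = "p_of n R0 R1"
    have eqs: "- deriv (deriv u) t = ?p t * f1 (?r t) (u t) (v t) (y1 t) (y2 t)"
      "- deriv (deriv v) t = ?p t * f2 (?r t) (u t) (v t) (y1 t) (y2 t)"
      if "t \<in> {0<..<1}" for t
      using sol that by (auto simp: radial_solution_def g_of_def y1_def y2_def)
    \<comment> \<open>Quotients of absolute values are nonnegative, also under the convention
      \<open>x / 0 = 0\<close>, so the gradient arguments stay in the domain of the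
      nonlinearities.\<close>
    have y: "0 \<le> y1 t" "0 \<le> y2 t" for t by (auto simp: y1_def y2_def)
    have r: "?r t \<in> {R0..R1}" and p: "0 < ?p t"
      and pS: "?p t \<le> (SUP t\<in>{0..1}. ?p t)" and uv: "0 \<le> u t" "0 \<le> v t"
      if "t \<in> {0..1}" for t
      using that r_of_mem p_of_pos p_of_le_SUP n R cone_nonneg[OF uK] cone_nonneg[OF vK] by auto
    have f0: "0 \<le> f1 (?r t) (u t) (v t) (y1 t) (y2 t)"
      "0 \<le> f2 (?r t) (u t) (v t) (y1 t) (y2 t)" if "t \<in> {0..1}" for t
      by (rule admissible_nonneg[OF f(1) r[OF that] uv[OF that] y]
          admissible_nonneg[OF f(2) r[OF that] uv[OF that] y])+
    have concave: "deriv (deriv u) t \<le> 0" "deriv (deriv v) t \<le> 0" if "t \<in> {0<..<1}" for t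
    proof -
      have "0 \<le> - deriv (deriv u) t" "0 \<le> - deriv (deriv v) t"
        unfolding eqs[OF that] using p[of t] f0[of t] that by auto
      then show "deriv (deriv u) t \<le> 0" "deriv (deriv v) t \<le> 0" by auto
    qed
    from cond show ?thesis
    proof (elim disjE)
      let ?S = "SUP t\<in>{0..1}. ?p t"
      assume upper: "\<forall>r\<in>{R0..R1}. \<forall>w1\<ge>0. \<forall>w2\<ge>0. \<forall>z1\<ge>0. \<forall>z2\<ge>0.
          (w1 > 0 \<longrightarrow> f1 r w1 w2 z1 z2 < m_const k1 / ?S * w1) \<and>
          (w2 > 0 \<longrightarrow> f2 r w1 w2 z1 z2 < m_const k2 / ?S * w2)"
      have "u t \<le> 0" if "t \<in> {0..1}" for t
      proof (rule dirichlet_upper[OF cu du ddu bc(1,2) _ that])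
        fix s N :: real assume s: "s \<in> {0<..<1}" and N: "0 < N" "u s \<le> N"
        then have s': "s \<in> {0..1}" by auto
        have "?p s * f1 (?r s) (u s) (v s) (y1 s) (y2 s) < 8 * N"
        proof (rule scaled_upper[OF p[OF s'] pS[OF s'] _ N(1) uv(1)[OF s'] N(2)])
          show "f1 (?r s) (u s) (v s) (y1 s) (y2 s) < 8 / ?S * u s" if "0 < u s"
            using upper r[OF s'] uv[OF s'] y that by (simp add: m_const_k1)
          \<comment> \<open>The other arguments are frozen and the limit is taken in the first
            unknown alone.\<close>
          have "f1 (?r s) 0 (v s) (y1 s) (y2 s) \<le> 0"
            using upper r[OF s'] uv[OF s'] y
            by (intro nonpos_at_zero[where C = "m_const k1 / ?S"]
                admissible_continuous_args[OF f(1)]) auto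
          then show "f1 (?r s) (u s) (v s) (y1 s) (y2 s) \<le> 0" if "u s = 0"
            using that by simp
        qed auto
        then show "- deriv (deriv u) s < 8 * N" using eqs[OF s] by simp
      qed
      moreover have "v t \<le> 0" if "t \<in> {0..1}" for t
      proof (rule mixed_upper[OF cv dv ddv bc(3,4) _ that])
        fix s N :: real assume s: "s \<in> {0<..<1}" and N: "0 < N" "v s \<le> N"
        then have s': "s \<in> {0..1}" by auto
        have "?p s * f2 (?r s) (u s) (v s) (y1 s) (y2 s) < 2 * N"
        proof (rule scaled_upper[OF p[OF s'] pS[OF s'] _ N(1) uv(2)[OF s'] N(2)])
          show "f2 (?r s) (u s) (v s) (y1 s) (y2 s) < 2 / ?S * v s" if "0 < v s"
            using upper r[OF s'] uv[OF s'] y that by (simp add: m_const_k2)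
          have "f2 (?r s) (u s) 0 (y1 s) (y2 s) \<le> 0"
            using upper r[OF s'] uv[OF s'] y
            by (intro nonpos_at_zero[where C = "m_const k2 / ?S"]
                admissible_continuous_args[OF f(2)]) auto
          then show "f2 (?r s) (u s) (v s) (y1 s) (y2 s) \<le> 0" if "v s = 0"
            using that by simp
        qed auto
        then show "- deriv (deriv v) s < 2 * N" using eqs[OF s] by simp
      qed
      ultimately show ?thesis using uv by (simp add: order_antisym)
    next
      assume lower: "\<forall>r\<in>{R0..R1}. \<forall>w1\<ge>0. \<forall>w2\<ge>0. \<forall>z1\<ge>0. \<forall>z2\<ge>0.
          (w1 > 0 \<longrightarrow> f1 r w1 w2 z1 z2 > M_const k1 a1 b1 / (INF t\<in>{a1..b1}. ?p t) * w1) \<and>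
          (w2 > 0 \<longrightarrow> f2 r w1 w2 z1 z2 > M_const k2 a2 b2 / (INF t\<in>{a2..b2}. ?p t) * w2)"
      have inf: "0 < (INF t\<in>{a..b}. ?p t)"
        "t \<in> {a..b} \<Longrightarrow> (INF t\<in>{a..b}. ?p t) \<le> ?p t"
        if "0 < a" "a < b" "b \<le> 1" for a b t
        using that p by (auto intro!: INF_pos_if_continuous
            continuous_on_subset[OF continuous_on_p_of[OF n R]])
      have "u t = 0" if t: "t \<in> {0..1}" for t
      proof (rule ccontr)
        assume nz: "u t \<noteq> 0"
        \<comment> \<open>Positivity on the whole interval makes condition (ii) applicable at each
          of its points.\<close>
        have pos: "0 < u s" if "s \<in> {a1..b1}" for s
          by (rule cone_pos[OF uK _ _ t nz that]) (use ab1' in auto)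
        show False
        proof (rule dirichlet_lower_contra[OF cu du ddu concave(1) _ _ ab1'(1) ab1(1) ab1'(2) pos])
          fix s assume s: "s \<in> {a1..b1}"
          then have s': "s \<in> {0<..<1}" "s \<in> {0..1}" using ab1' by auto
          have "M_const k1 a1 b1 * u s < ?p s * f1 (?r s) (u s) (v s) (y1 s) (y2 s)"
            using lower r[OF s'(2)] uv[OF s'(2)] y pos[OF s] s ab1 ab1' M_const_k1(1) inf
            by (intro scaled_lower[where S = "INF t\<in>{a1..b1}. ?p t"]) auto
          then show "M_const k1 a1 b1 * u s < - deriv (deriv u) s" using eqs[OF s'(1)] by simp
        qed (use bc in auto)
      qed
      moreover have "v t = 0" if t: "t \<in> {0..1}" for t
      proof (rule ccontr)
        assume nz: "v t \<noteq> 0"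
        have pos: "0 < v s" if "s \<in> {a2..b2}" for s
          by (rule cone_pos[OF vK _ _ t nz that]) (use ab2' in auto)
        show False
        proof (rule mixed_lower_contra[OF cv dv ddv concave(2) _ bc(4) ab2'(1) ab2(1) ab2'(2)])
          \<comment> \<open>\<open>b2\<close> is left out because it may equal 1, where the
            differential equation is not imposed.\<close>
          fix s assume s: "s \<in> {a2..<b2}"
          then have s': "s \<in> {0<..<1}" "s \<in> {0..1}" "s \<in> {a2..b2}" using ab2' by auto
          have "M_const k2 a2 b2 * v s < ?p s * f2 (?r s) (u s) (v s) (y1 s) (y2 s)"
            using lower r[OF s'(2)] uv[OF s'(2)] y pos[OF s'(3)] s ab2 ab2' M_const_k2(1) inf
            by (intro scaled_lower[where S = "INF t\<in>{a2..b2}. ?p t"]) auto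
          then show "M_const k2 a2 b2 * v s < - deriv (deriv v) s" using eqs[OF s'(1)] by simp
        qed (use bc pos ab2 in auto)
      qed
      ultimately show ?thesis by simp
    qed
  qed
  moreover have "\<not> positive_radial_solution n R0 R1 f1 f2 a1 b1 a2 b2 u v" for u v
  proof
    assume "positive_radial_solution n R0 R1 f1 f2 a1 b1 a2 b2 u v"
    then have *: "(u, v) \<in> cone_K a1 b1 a2 b2" "radial_solution n R0 R1 f1 f2 u v"
      "0 < pair_norm (u, v)" by (auto simp: positive_radial_solution_def)
    \<comment> \<open>Positivity of a solution is measured by the norm, so pointwise vanishing has
      to be turned into vanishing of both norms.\<close>
    have "weighted_norm omega1 u = 0" "weighted_norm omega2 v = 0"
      using * zero[OF *(1,2)] by (auto simp: cone_K_def intro!: weighted_norm_zero)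
    with *(3) show False by (simp add: pair_norm_def)
  qed
  ultimately show ?thesis by blast
qed

end
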